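(* The isometry group of the real projective plane $\mathbb{R}P^2$ is generated by involutions, and any relation among the involutions of the projective plane is a corollary of the pencil, involution and polar frame relations for $\mathbb{R}P^2$. That is, if $p_1,\dots,p_n\in\mathbb{R}P^2$ satisfy $\iota_{p_1}\circ\iota_{p_2}\circ\dots\circ\iota_{p_n}=\mathrm{id}$, then this relation is a consequence of pencil, involution and polar frame relations.
   Context: $\mathbb{R}P^2$ is the set of lines through the origin in $\mathbb{R}^3$, with the metric defined by the Euclidean metric of $\mathbb{R}^3$ (the distance between two points is the angle between the corresponding lines); equivalently, it is the quotient of the unit sphere $S^2$ by the antipodal involution. The fixed point set of any isometry of $\mathbb{R}P^2$ that is a (non-identity) involution consists of a point $p$ and the line polar to $p$; for each $p\in\mathbb{R}P^2$ there is exactly one such involution, denoted $\iota_p$. It is the isometry of $\mathbb{R}P^2$ induced by the rotation $R_a$ of $\mathbb{R}^3$ by $180^\circ$ about the line $a\subset \mathbb{R}^3$ representing $p$. Each isometry of $\mathbb{R}P^2$ has a unique orientation preserving lifting to an isometry of $S^2$, and this identifies the isometry group of $\mathbb{R}P^2$ with $SO(3)$, $\iota_p$ corresponding to $R_a$. The relations are those corresponding to the following relations in $SO(3)$. Pencil relation: an equality $\iota_q\circ\iota_p=\iota_s\circ\iota_r$ that holds in the isometry group, where $p,q,r,s$ lie on one projective line, $\operatorname{dist}(p,q)=\operatorname{dist}(r,s)$ and $\operatorname{dist}(p,r)=\operatorname{dist}(q,s)$. Involution relation: $\iota_p^2=\mathrm{id}$. Polar frame relation: $\iota_r\circ\iota_q\circ\iota_p=\mathrm{id}$,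 where $p,q,r$ are represented by pairwise orthogonal lines of $\mathbb{R}^3$. A relation $\iota_{p_1}\circ\dots\circ\iota_{p_n}=\mathrm{id}$ is a corollary (consequence) of these relations if, in the free group on the set of symbols $\{x_p\}$ indexed by $p\in\mathbb{R}P^2$, the word $x_{p_1}x_{p_2}\cdots x_{p_n}$ lies in the normal closure of the set of all elements $x_p^2$, $x_qx_p(x_sx_r)^{-1}$ and $x_rx_qx_p$ corresponding to involution, pencil and polar frame relations respectively. *)

theory Defs
  imports "HOL-Analysis.Analysis" "HOL-Algebra.Coset" "HOL-Algebra.Generated_Groups"
begin

section \<open>The real projective plane\<close>

typedef rp2 = "{l :: (real^3) set. subspace l \<and> dim l = 1}"
  morphisms line_of abs_rp2
proof
  show "span {axis 1 1} \<in> {l :: (real^3) set. subspace l \<and> dim l = 1}"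
    by (simp add: dim_insert axis_eq_0_iff)
qed

setup_lifting type_definition_rp2

lemma subspace_line_of: "subspace (line_of p)"
  and dim_line_of: "dim (line_of p) = 1"
  using line_of[of p] by auto

lemma line_eq_span:
  fixes l :: "(real^3) set"
  assumes "subspace l" "dim l = 1" "u \<in> l" "u \<noteq> 0"
  shows "l = span {u}"
proof -
  have "span {u} \<subseteq> l"
    using assms by (simp add: span_minimal)
  moreover have "dim (span {u}) = 1"
    using assms(4) by (simp add: dim_insert)
  ultimately show ?thesis
    using assms(1,2) by (metis order_refl subspace_dim_equal subspace_span)
qed

lemma line_obtain_unit:
  fixes l :: "(real^3) set"
  assumes "subspace l" "dim l = 1"
  obtains u where "norm u = 1" "l = span {u}"
proof -
  have "\<not> l \<subseteq> {0}"
    using assms(2) by (metis dim_eq_0 zero_neq_one)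
  then obtain v where v: "v \<in> l" "v \<noteq> 0"
    by auto
  let ?u = "v /\<^sub>R norm v"
  have "?u \<in> l" "?u \<noteq> 0" "norm ?u = 1"
    using v assms(1) by (simp_all add: subspace_scale)
  then show ?thesis
    using line_eq_span[OF assms] that by blast
qed

text \<open>The distance is the angle between the lines, in the interval from 0 to \<open>pi / 2\<close>.
  It does not depend on the vectors chosen to represent the lines.\<close>

definition rp2_dist :: "rp2 \<Rightarrow> rp2 \<Rightarrow> real" where
  "rp2_dist p q = (THE \<theta>. \<exists>u\<in>line_of p. \<exists>v\<in>line_of q. u \<noteq> 0 \<and> v \<noteq> 0 \<and>
     \<theta> = arccos (\<bar>u \<bullet> v\<bar> / (norm u * norm v)))"

lemma rp2_dist_eq:
  assumes "u \<in> line_of p" "u \<noteq> 0" "v \<in> line_of q" "v \<noteq> 0"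
  shows "rp2_dist p q = arccos (\<bar>u \<bullet> v\<bar> / (norm u * norm v))"
  unfolding rp2_dist_def
proof (rule the_equality)
  show "\<exists>u'\<in>line_of p. \<exists>v'\<in>line_of q. u' \<noteq> 0 \<and> v' \<noteq> 0 \<and>
     arccos (\<bar>u \<bullet> v\<bar> / (norm u * norm v)) = arccos (\<bar>u' \<bullet> v'\<bar> / (norm u' * norm v'))"
    using assms by blast
next
  fix \<theta>
  assume "\<exists>u'\<in>line_of p. \<exists>v'\<in>line_of q. u' \<noteq> 0 \<and> v' \<noteq> 0 \<and>
     \<theta> = arccos (\<bar>u' \<bullet> v'\<bar> / (norm u' * norm v'))"
  then obtain u' v' where *: "u' \<in> line_of p" "v' \<in> line_of q" "u' \<noteq> 0" "v' \<noteq> 0"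
    and th: "\<theta> = arccos (\<bar>u' \<bullet> v'\<bar> / (norm u' * norm v'))"
    by blast
  have "line_of p = span {u}" "line_of q = span {v}"
    using line_eq_span[OF subspace_line_of dim_line_of] assms by auto
  then obtain a b where ab: "u' = a *\<^sub>R u" "v' = b *\<^sub>R v"
    using * by (auto simp: span_singleton)
  have "a \<noteq> 0" "b \<noteq> 0"
    using ab * by auto
  then show "\<theta> = arccos (\<bar>u \<bullet> v\<bar> / (norm u * norm v))"
    unfolding th ab by (simp add: abs_mult)
qed

definition rp2_orthogonal :: "rp2 \<Rightarrow> rp2 \<Rightarrow> bool" where
  "rp2_orthogonal p q \<longleftrightarrow> (\<forall>u\<in>line_of p. \<forall>v\<in>line_of q. orthogonal u v)"

text \<open>A projective line consists of the lines contained in a plane through the origin.\<close>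

definition rp2_collinear :: "rp2 set \<Rightarrow> bool" where
  "rp2_collinear S \<longleftrightarrow>
     (\<exists>P :: (real^3) set. subspace P \<and> dim P = 2 \<and> (\<forall>p\<in>S. line_of p \<subseteq> P))"

section \<open>Isometries and the involutions\<close>

definition isometry_group :: "(rp2 \<Rightarrow> rp2) monoid" where
  "isometry_group =
     \<lparr>carrier = {f. bij f \<and> (\<forall>p q. rp2_dist (f p) (f q) = rp2_dist p q)}, mult = (\<circ>), one = id\<rparr>"

lemma group_isometry_group: "group isometry_group"
proof (rule groupI)
  fix f assume "f \<in> carrier isometry_group"
  then have f: "bij f" "\<And>p q. rp2_dist (f p) (f q) = rp2_dist p q"
    by (auto simp: isometry_group_def)
  have "rp2_dist (inv_into UNIV f p) (inv_into UNIV f q) = rp2_dist p q" for p q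
    using f(2)[of "inv_into UNIV f p" "inv_into UNIV f q"] f(1)
    by (simp add: bij_is_surj surj_f_inv_f)
  then have "inv_into UNIV f \<in> carrier isometry_group"
    using f(1) by (auto simp: isometry_group_def bij_imp_bij_inv)
  moreover have "inv_into UNIV f \<circ> f = id"
    using f(1) by (simp add: bij_is_inj)
  ultimately show "\<exists>g\<in>carrier isometry_group. g \<otimes>\<^bsub>isometry_group\<^esub> f = \<one>\<^bsub>isometry_group\<^esub>"
    by (auto simp: isometry_group_def)
qed (auto simp: isometry_group_def bij_comp o_assoc)

text \<open>The rotation by a half turn about a line \<open>a\<close> through the origin.
  Here \<^term>\<open>closest_point a x\<close> is the orthogonal projection of \<open>x\<close> to \<open>a\<close>.\<close>

definition half_turn :: "(real^3) set \<Rightarrow> real^3 \<Rightarrow> real^3" where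
  "half_turn a x = 2 *\<^sub>R closest_point a x - x"

lemma half_turn_eq:
  assumes "norm u = 1"
  shows "half_turn (span {u}) x = (2 * (u \<bullet> x)) *\<^sub>R u - x"
proof -
  have uu: "u \<bullet> u = 1"
    using assms by (simp add: dot_square_norm)
  have "dist x ((u \<bullet> x) *\<^sub>R u) \<le> dist x y" if y_in: "y \<in> span {u}" for y
  proof -
    obtain c where y: "y = c *\<^sub>R u"
      using y_in by (auto simp: span_singleton)
    have "(norm (x - y))\<^sup>2 - (norm (x - (u \<bullet> x) *\<^sub>R u))\<^sup>2 = (c - u \<bullet> x)\<^sup>2"
      unfolding power2_norm_eq_inner y
      by (simp add: inner_diff_left inner_diff_right uu inner_commute power2_eq_square algebra_simps)
    then have "(norm (x - (u \<bullet> x) *\<^sub>R u))\<^sup>2 \<le> (norm (x - y))\<^sup>2"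
      using zero_le_power2[of "c - u \<bullet> x"] by linarith
    then show ?thesis
      by (simp add: dist_norm)
  qed
  then have "(u \<bullet> x) *\<^sub>R u = closest_point (span {u}) x"
    by (intro closest_point_unique)
       (auto simp: subspace_imp_convex closed_subspace span_base span_scale)
  then show ?thesis
    unfolding half_turn_def by (metis scaleR_scaleR)
qed

lemma half_turn_on_axis:
  assumes "norm u = 1" "x \<in> span {u}"
  shows "half_turn (span {u}) x = x"
  using assms by (simp add: half_turn_def closest_point_self scaleR_2)

lemma half_turn_on_complement:
  assumes "norm u = 1" "orthogonal u x"
  shows "half_turn (span {u}) x = - x"
  using assms by (simp add: half_turn_eq orthogonal_def)

lemma orthogonal_transformation_half_turn:
  assumes "subspace a" "dim a = 1"
  shows "orthogonal_transformation (half_turn a)"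
proof -
  obtain u where u: "norm u = 1" "a = span {u}"
    using line_obtain_unit[OF assms] .
  have uu: "u \<bullet> u = 1"
    using u(1) by (simp add: dot_square_norm)
  have "half_turn a = (\<lambda>x. (2 * (u \<bullet> x)) *\<^sub>R u - x)"
    using half_turn_eq[OF u(1)] u(2) by auto
  moreover have "linear (\<lambda>x. (2 * (u \<bullet> x)) *\<^sub>R u - x)"
    by (rule linearI) (simp_all add: inner_add_right algebra_simps)
  ultimately show ?thesis
    unfolding orthogonal_transformation_def
    by (simp add: inner_diff_left inner_diff_right uu inner_commute algebra_simps)
qed

lift_definition iota :: "rp2 \<Rightarrow> rp2 \<Rightarrow> rp2" is "\<lambda>a l. half_turn a ` l"
proof -
  fix a l :: "(real^3) set"
  assume a: "subspace a \<and> dim a = 1" and l: "subspace l \<and> dim l = 1"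
  have o: "orthogonal_transformation (half_turn a)"
    using a orthogonal_transformation_half_turn by blast
  show "subspace (half_turn a ` l) \<and> dim (half_turn a ` l) = 1"
    using o l dim_image_eq[OF orthogonal_transformation_linear[OF o], of l]
    by (simp add: linear_subspace_image orthogonal_transformation_linear
        inj_on_subset[OF orthogonal_transformation_inj[OF o]])
qed

text \<open>The lemmas below confirm that \<^term>\<open>iota p\<close> is an isometry and a nontrivial involution
  whose fixed points are \<open>p\<close> and the points of the line polar to \<open>p\<close>.\<close>

lemma iota_iota: "iota p (iota p q) = q"
proof -
  obtain u where u: "norm u = 1" "line_of p = span {u}"
    using line_obtain_unit[OF subspace_line_of dim_line_of] .
  have uu: "u \<bullet> u = 1"
    using u(1) by (simp add: dot_square_norm)
  have "half_turn (line_of p) (half_turn (line_of p) x) = x" for x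
    by (simp add: u half_turn_eq inner_diff_right uu algebra_simps)
  then have "line_of (iota p (iota p q)) = line_of q"
    by (simp add: iota.rep_eq image_image)
  then show ?thesis
    by (simp add: line_of_inject)
qed

lemma iota_isometry: "iota p \<in> carrier isometry_group"
proof -
  have "bij (iota p)"
    by (rule involuntory_imp_bij) (rule iota_iota)
  moreover have "rp2_dist (iota p q) (iota p r) = rp2_dist q r" for q r
  proof -
    obtain u where u: "norm u = 1" "line_of q = span {u}"
      using line_obtain_unit[OF subspace_line_of dim_line_of] .
    obtain v where v: "norm v = 1" "line_of r = span {v}"
      using line_obtain_unit[OF subspace_line_of dim_line_of] .
    have o: "orthogonal_transformation (half_turn (line_of p))"
      by (rule orthogonal_transformation_half_turn[OF subspace_line_of dim_line_of])
    let ?h = "half_turn (line_of p)"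
    have h: "?h u \<in> line_of (iota p q)" "?h v \<in> line_of (iota p r)"
      "?h u \<bullet> ?h v = u \<bullet> v" "norm (?h u) = 1" "norm (?h v) = 1"
      using o u v
      by (auto simp: iota.rep_eq orthogonal_transformation_def span_base
          orthogonal_transformation_norm)
    then have "rp2_dist (iota p q) (iota p r) = arccos \<bar>u \<bullet> v\<bar>"
      using rp2_dist_eq[of "?h u" "iota p q" "?h v" "iota p r"] by fastforce
    moreover have "rp2_dist q r = arccos \<bar>u \<bullet> v\<bar>"
      using rp2_dist_eq[of u q v r] u v by (fastforce simp: span_base)
    ultimately show ?thesis
      by simp
  qed
  ultimately show ?thesis
    by (simp add: isometry_group_def)
qed

lemma iota_fixed_points: "iota p q = q \<longleftrightarrow> q = p \<or> rp2_orthogonal p q"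
proof -
  obtain u where u: "norm u = 1" "line_of p = span {u}"
    using line_obtain_unit[OF subspace_line_of dim_line_of] .
  obtain v where v: "norm v = 1" "line_of q = span {v}"
    using line_obtain_unit[OF subspace_line_of dim_line_of] .
  have orth: "rp2_orthogonal p q \<longleftrightarrow> u \<bullet> v = 0"
    unfolding rp2_orthogonal_def u v by (auto simp: span_singleton orthogonal_def)
  show ?thesis
  proof
    assume "iota p q = q"
    then have "half_turn (line_of p) ` line_of q = line_of q"
      by (metis iota.rep_eq)
    moreover have "v \<in> line_of q"
      by (simp add: v span_base)
    ultimately have "half_turn (line_of p) v \<in> line_of q"
      by blast
    then have "(2 * (u \<bullet> v)) *\<^sub>R u \<in> line_of q"
      using subspace_add[OF subspace_line_of _ \<open>v \<in> line_of q\<close>]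
      by (fastforce simp: u half_turn_eq)
    then have "u \<bullet> v = 0 \<or> u \<in> line_of q"
      using subspace_scale[OF subspace_line_of, of "(2 * (u \<bullet> v)) *\<^sub>R u" q "1 / (2 * (u \<bullet> v))"]
      by (cases "u \<bullet> v = 0") simp_all
    moreover have "line_of q = line_of p" if "u \<in> line_of q"
      using that u line_eq_span[OF subspace_line_of dim_line_of] by fastforce
    ultimately show "q = p \<or> rp2_orthogonal p q"
      using orth line_of_inject by blast
  next
    assume *: "q = p \<or> rp2_orthogonal p q"
    have "half_turn (line_of p) ` line_of q = line_of q"
    proof (cases "q = p")
      case True
      then show ?thesis
        using half_turn_on_axis[OF u(1)] u(2) by force
    next
      case False
      then have "half_turn (line_of p) x = - x" if "x \<in> line_of q" for x
        using * that u half_turn_on_complement[OF u(1)]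
        by (auto simp: rp2_orthogonal_def span_base)
      then have "half_turn (line_of p) ` line_of q = uminus ` line_of q"
        by (rule image_cong[OF refl])
      also have "\<dots> = line_of q"
      proof -
        have "- x \<in> line_of q" if "x \<in> line_of q" for x
          using that by (rule subspace_neg[OF subspace_line_of])
        then show ?thesis
          by (force intro: image_eqI[where x = "- x" for x])
      qed
      finally show ?thesis .
    qed
    then show "iota p q = q"
      by (metis iota.rep_eq line_of_inject)
  qed
qed

lemma iota_not_id: "iota p \<noteq> id"
proof
  assume "iota p = id"
  then have "q = p \<or> rp2_orthogonal p q" for q
    using iota_fixed_points[of p q] by simp
  moreover obtain u where u: "norm u = 1" "line_of p = span {u}"
    using line_obtain_unit[OF subspace_line_of dim_line_of] .
  moreover obtain w :: "real^3" where w: "w \<noteq> 0" "orthogonal w u"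
    using orthogonal_to_vector_exists[of u] by (auto simp: orthogonal_commute)
  moreover define q where "q = abs_rp2 (span {u + w})"
  moreover have uw: "u \<bullet> (u + w) = 1"
    using u(1) w by (auto simp: inner_add_right orthogonal_def inner_commute dot_square_norm)
  moreover have "u + w \<noteq> 0"
    using uw by (metis inner_zero_right zero_neq_one)
  moreover have "line_of q = span {u + w}"
    unfolding q_def using \<open>u + w \<noteq> 0\<close> by (subst abs_rp2_inverse) (auto simp: dim_insert)
  moreover have "q \<noteq> p"
  proof
    assume "q = p"
    then have "u + w \<in> span {u}"
      using \<open>line_of q = span {u + w}\<close> u(2) by (metis span_base singletonI)
    then have "w \<in> span {u}"
      by (metis add_diff_cancel_left' singletonI span_base span_diff)
    then show False
      using w by (auto simp: span_singleton orthogonal_def)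
  qed
  ultimately show False
    unfolding rp2_orthogonal_def orthogonal_def by (metis singletonI span_base zero_neq_one)
qed

section \<open>Free groups and normal closures\<close>

text \<open>A letter \<open>(x, True)\<close> stands for the generator \<open>x\<close> and \<open>(x, False)\<close> for its inverse.\<close>

inductive cancel :: "('a \<times> bool) list \<Rightarrow> ('a \<times> bool) list \<Rightarrow> bool" where
  "cancel (xs @ (x, b) # (x, \<not> b) # ys) (xs @ ys)"

quotient_type 'a free_group = "('a \<times> bool) list" / "equivclp cancel"
  by (rule equivp_evquivclp)

lemma equivclp_map:
  assumes "\<And>x y. r x y \<Longrightarrow> equivclp s (f x) (f y)" "equivclp r x y"
  shows "equivclp s (f x) (f y)"
  using assms(2)
proof (induction rule: equivclp_induct)
  case base
  show ?case by simp
next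
  case (step y z)
  then show ?case
    using assms(1) by (metis equivclp_sym equivclp_trans)
qed

lemma cancel_append:
  assumes "cancel u v"
  shows "cancel (w @ u) (w @ v)" "cancel (u @ w) (v @ w)"
proof -
  obtain xs x b ys where *: "u = xs @ (x, b) # (x, \<not> b) # ys" "v = xs @ ys"
    using assms by (auto elim: cancel.cases)
  show "cancel (w @ u) (w @ v)"
    using cancel.intros[of "w @ xs" x b ys] * by simp
  show "cancel (u @ w) (v @ w)"
    using cancel.intros[of xs x b "ys @ w"] * by simp
qed

lift_definition fg_mult :: "'a free_group \<Rightarrow> 'a free_group \<Rightarrow> 'a free_group" is "(@)"
proof -
  fix u u' v v' :: "('a \<times> bool) list"
  assume "equivclp cancel u u'" "equivclp cancel v v'"
  then have "equivclp cancel (u @ v) (u' @ v)" "equivclp cancel (u' @ v) (u' @ v')"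
    using equivclp_map[of cancel cancel "\<lambda>w. w @ v"] equivclp_map[of cancel cancel "\<lambda>w. u' @ w"]
      cancel_append r_into_equivclp by metis+
  then show "equivclp cancel (u @ v) (u' @ v')"
    by (rule equivclp_trans)
qed

lift_definition fg_one :: "'a free_group" is "[]" .

lift_definition fg_gen :: "'a \<Rightarrow> 'a free_group" is "\<lambda>x. [(x, True)]" .

definition free_group :: "'a free_group monoid" where
  "free_group = \<lparr>carrier = UNIV, mult = fg_mult, one = fg_one\<rparr>"

lemma fg_left_inverse: "\<exists>h. fg_mult h g = fg_one"
proof transfer
  fix u :: "('a \<times> bool) list"
  show "\<exists>v. equivclp cancel (v @ u) []"
  proof (induction u)
    case Nil
    show ?case
      by (rule exI[of _ "[]"]) simp
  next
    case (Cons a u)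
    then obtain v where v: "equivclp cancel (v @ u) []"
      by blast
    obtain x b where a: "a = (x, b)"
      by (cases a)
    have "cancel (v @ (x, \<not> b) # (x, \<not> \<not> b) # u) (v @ u)"
      by (rule cancel.intros)
    then have "equivclp cancel ((v @ [(x, \<not> b)]) @ a # u) (v @ u)"
      using a by (simp add: r_into_equivclp)
    then show ?case
      using v equivclp_trans by metis
  qed
qed

lemma group_free_group: "group free_group"
proof (rule groupI)
  fix g :: "'a free_group"
  show "\<exists>h\<in>carrier free_group. h \<otimes>\<^bsub>free_group\<^esub> g = \<one>\<^bsub>free_group\<^esub>"
    using fg_left_inverse[of g] by (simp add: free_group_def)
qed (simp_all add: free_group_def, (transfer, simp)+)

definition normal_closure :: "('a, 'b) monoid_scheme \<Rightarrow> 'a set \<Rightarrow> 'a set" where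
  "normal_closure G S = \<Inter>{N. N \<lhd> G \<and> S \<subseteq> N}"

section \<open>The relations\<close>

definition involution_relators :: "rp2 free_group set" where
  "involution_relators = {fg_gen p \<otimes>\<^bsub>free_group\<^esub> fg_gen p | p. True}"

definition pencil_relators :: "rp2 free_group set" where
  "pencil_relators =
     {fg_gen q \<otimes>\<^bsub>free_group\<^esub> fg_gen p \<otimes>\<^bsub>free_group\<^esub>
        inv\<^bsub>free_group\<^esub> (fg_gen s \<otimes>\<^bsub>free_group\<^esub> fg_gen r) | p q r s.
        rp2_collinear {p, q, r, s} \<and> rp2_dist p q = rp2_dist r s \<and> rp2_dist p r = rp2_dist q s \<and>
        iota q \<circ> iota p = iota s \<circ> iota r}"

definition polar_frame_relators :: "rp2 free_group set" where
  "polar_frame_relators =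
     {fg_gen r \<otimes>\<^bsub>free_group\<^esub> fg_gen q \<otimes>\<^bsub>free_group\<^esub> fg_gen p | p q r.
        rp2_orthogonal p q \<and> rp2_orthogonal q r \<and> rp2_orthogonal p r}"

definition iota_composition :: "rp2 list \<Rightarrow> rp2 \<Rightarrow> rp2" where
  "iota_composition ps = foldr (\<circ>) (map iota ps) id"

definition relation_word :: "rp2 list \<Rightarrow> rp2 free_group" where
  "relation_word ps = foldr (\<otimes>\<^bsub>free_group\<^esub>) (map fg_gen ps) \<one>\<^bsub>free_group\<^esub>"

end

theory Submission
  imports Defs
begin

text \<open>Any three half turns compose to two, using the given relations only: the projective line \<open>pq\<close>
  meets the polar line of \<open>r\<close> in a point \<open>c\<close>. A pencil relation slides the pair \<open>p, q\<close> along its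
  line until the second point is \<open>c\<close>, and a polar frame relation replaces \<open>\<iota>\<^sub>r\<close> by
  \<open>\<iota>\<^sub>c \<circ> \<iota>\<^sub>d\<close>; then \<open>\<iota>\<^sub>c\<^sup>2\<close> cancels. So every word reduces to one of length at most two, where a trivial
  composition can only be empty or of the form \<open>\<iota>\<^sub>p\<^sup>2\<close>.

  An isometry is made to fix the coordinate axes and \<open>[1:1:1]\<close> by composing it with involutions.
  It then fixes every point with nonnegative coordinates, in particular the three \<open>[e\<^sub>i + e\<^sub>j]\<close>, and
  the angles with these and the axes determine all products \<open>x\<^sub>i x\<^sub>j\<close>, hence the point.\<close>

section \<open>Orthonormal frames and homogeneous coordinates\<close>

text \<open>A dimension count that also covers dependent \<open>a\<close> and \<open>b\<close>, so
  that coinciding points need no case distinction later.\<close>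

lemma exists_unit_orthogonal_to_pair:
  fixes a b :: "real^3"
  obtains n where "norm n = 1" "n \<bullet> a = 0" "n \<bullet> b = 0"
proof -
  have "card {a, b} \<le> 2"
    by (simp add: card_insert_if)
  then have "dim {a, b} < DIM(real^3)"
    using dim_le_card'[of "{a, b}"] by simp
  then obtain x where x: "x \<noteq> 0" "\<And>y. y \<in> span {a, b} \<Longrightarrow> orthogonal x y"
    using orthogonal_to_subspace_exists by blast
  show ?thesis
  proof
    show "norm (x /\<^sub>R norm x) = 1"
      using x(1) by simp
    show "(x /\<^sub>R norm x) \<bullet> a = 0" "(x /\<^sub>R norm x) \<bullet> b = 0"
      using x(2)[of a] x(2)[of b] by (auto simp: span_base orthogonal_def)
  qed
qed

lemma frame_expansion:
  fixes a b c x :: "real^3"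
  assumes "norm a = 1" "norm b = 1" "norm c = 1" "a \<bullet> b = 0" "a \<bullet> c = 0" "b \<bullet> c = 0"
  shows "(a \<bullet> x) *\<^sub>R a + (b \<bullet> x) *\<^sub>R b + (c \<bullet> x) *\<^sub>R c = x"
proof -
  have ne: "a \<noteq> b" "a \<noteq> c" "b \<noteq> c" "a \<noteq> 0" "b \<noteq> 0" "c \<noteq> 0"
    using assms by auto
  have po: "pairwise orthogonal {a, b, c}"
    using assms by (auto simp: pairwise_insert orthogonal_def inner_commute)
  then have "independent {a, b, c}"
    using ne by (intro pairwise_orthogonal_independent) auto
  then have "span {a, b, c} = UNIV"
    using ne card_ge_dim_independent[of "{a, b, c}" UNIV] by auto
  then have "(\<Sum>i\<in>{a, b, c}. (x \<bullet> i) *\<^sub>R i) = x"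
    using po assms by (intro orthonormal_basis_expand) auto
  then show ?thesis
    using ne by (simp add: inner_commute add.assoc)
qed

text \<open>The point with homogeneous coordinates \<open>u\<close>. It is meaningful only for
  nonzero \<open>u\<close>: the span of the zero vector is not a line.\<close>

definition pt :: "real^3 \<Rightarrow> rp2" where
  "pt u = abs_rp2 (span {u})"

lemma line_of_pt: "u \<noteq> 0 \<Longrightarrow> line_of (pt u) = span {u}"
  unfolding pt_def by (subst abs_rp2_inverse) (auto simp: dim_insert)

text \<open>The free choice of the norm allows a point and its image under an isometry to be
  represented by vectors of equal length.\<close>

lemma rp2_obtain_pt:
  assumes "r > 0"
  obtains u where "norm u = r" "p = pt u"
proof -
  obtain v where v: "norm v = 1" "line_of p = span {v}"
    using line_obtain_unit[OF subspace_line_of dim_line_of] .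
  have "r *\<^sub>R v \<in> line_of p" "r *\<^sub>R v \<noteq> 0"
    using v assms by (auto simp: span_base span_scale)
  then have "line_of p = line_of (pt (r *\<^sub>R v))"
    using line_eq_span[OF subspace_line_of dim_line_of] line_of_pt by metis
  then have "p = pt (r *\<^sub>R v)"
    by (simp add: line_of_inject)
  then show ?thesis
    using that[of "r *\<^sub>R v"] v assms by simp
qed

lemma pt_scale:
  assumes "c \<noteq> 0"
  shows "pt (c *\<^sub>R u) = pt u"
proof (cases "u = 0")
  case False
  then have "c *\<^sub>R u \<in> line_of (pt u)" "c *\<^sub>R u \<noteq> 0"
    using assms by (auto simp: line_of_pt span_base span_scale)
  then have "line_of (pt u) = line_of (pt (c *\<^sub>R u))"
    using line_eq_span[OF subspace_line_of dim_line_of] line_of_pt by metis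
  then show ?thesis
    by (simp add: line_of_inject)
qed simp

lemma pt_minus: "pt (- u) = pt u"
  using pt_scale[of "-1" u] by simp

text \<open>\<open>arccos\<close> is injective on [-1, 1], Cauchy-Schwarz puts both quotients there,
  and the equal norms make the denominators agree.\<close>

lemma rp2_dist_pt_eq_iff:
  assumes "norm u = norm u'" "norm v = norm v'" "u \<noteq> 0" "v \<noteq> 0"
  shows "rp2_dist (pt u) (pt v) = rp2_dist (pt u') (pt v') \<longleftrightarrow> \<bar>u \<bullet> v\<bar> = \<bar>u' \<bullet> v'\<bar>"
proof -
  have ne: "u' \<noteq> 0" "v' \<noteq> 0"
    using assms by auto
  have le: "\<bar>x \<bullet> y\<bar> / (norm x * norm y) \<le> 1" if "x \<noteq> 0" "y \<noteq> 0" for x y :: "real^3"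
    using that Cauchy_Schwarz_ineq2[of x y] by simp
  have d: "rp2_dist (pt x) (pt y) = arccos (\<bar>x \<bullet> y\<bar> / (norm x * norm y))"
    if "x \<noteq> 0" "y \<noteq> 0" for x y
    using that by (intro rp2_dist_eq) (auto simp: line_of_pt span_base)
  show ?thesis
    using assms ne le[of u v] le[of u' v']
    by (simp add: d arccos_eq_iff)
qed

lemma rp2_orthogonal_sym: "rp2_orthogonal p q \<Longrightarrow> rp2_orthogonal q p"
  unfolding rp2_orthogonal_def by (metis orthogonal_commute)

lemma rp2_orthogonal_pt:
  assumes "u \<noteq> 0" "v \<noteq> 0"
  shows "rp2_orthogonal (pt u) (pt v) \<longleftrightarrow> u \<bullet> v = 0"
  using assms unfolding rp2_orthogonal_def line_of_pt[OF assms(1)] line_of_pt[OF assms(2)]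
  by (auto simp: span_singleton orthogonal_def)

lemma iota_comp_eqI:
  assumes "\<And>x. half_turn (line_of a) (half_turn (line_of b) x) =
    half_turn (line_of c) (half_turn (line_of d) x)"
  shows "iota a \<circ> iota b = iota c \<circ> iota d"
proof
  fix l
  have "line_of ((iota a \<circ> iota b) l) = line_of ((iota c \<circ> iota d) l)"
    by (simp add: iota.rep_eq image_image assms)
  then show "(iota a \<circ> iota b) l = (iota c \<circ> iota d) l"
    by (simp add: line_of_inject)
qed

lemma half_turn_pt: "norm u = 1 \<Longrightarrow> half_turn (line_of (pt u)) x = (2 * (u \<bullet> x)) *\<^sub>R u - x"
  using half_turn_eq line_of_pt by (metis norm_zero zero_neq_one)

lemma iota_pt:
  assumes "norm u = 1" "v \<noteq> 0"
  shows "iota (pt u) (pt v) = pt ((2 * (u \<bullet> v)) *\<^sub>R u - v)"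
proof -
  let ?h = "half_turn (line_of (pt u))"
  have o: "orthogonal_transformation ?h"
    by (rule orthogonal_transformation_half_turn[OF subspace_line_of dim_line_of])
  then have "?h v \<noteq> 0"
    using assms(2) orthogonal_transformation_norm[OF o, of v] by auto
  moreover have "?h ` span {v} = span {?h v}"
    using linear_span_image[OF orthogonal_transformation_linear[OF o], of "{v}"] by simp
  ultimately have "line_of (iota (pt u) (pt v)) = line_of (pt (?h v))"
    using assms(2) by (simp add: iota.rep_eq line_of_pt)
  then show ?thesis
    by (simp add: half_turn_pt[OF assms(1)] line_of_inject)
qed

section \<open>Every relation reduces to length two\<close>

text \<open>The two half turns together negate the components along \<open>p\<close> and
  \<open>q\<close> and keep the one along \<open>r\<close>, just as the half turn about
  \<open>r\<close> does.\<close>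

lemma iota_polar_frame:
  assumes "rp2_orthogonal p q" "rp2_orthogonal q r" "rp2_orthogonal p r"
  shows "iota p \<circ> iota q = iota r"
proof -
  obtain a b c where u: "norm a = 1" "norm b = 1" "norm c = 1"
    and pt: "p = pt a" "q = pt b" "r = pt c"
    using rp2_obtain_pt[of 1] by (metis zero_less_one)
  have o: "a \<bullet> b = 0" "a \<bullet> c = 0" "b \<bullet> c = 0"
    using assms u unfolding pt by (subst (asm) rp2_orthogonal_pt; force)+
  have "half_turn (line_of p) (half_turn (line_of q) x) = half_turn (line_of r) x" for x
  proof -
    have "2 *\<^sub>R x = 2 *\<^sub>R ((a \<bullet> x) *\<^sub>R a + (b \<bullet> x) *\<^sub>R b + (c \<bullet> x) *\<^sub>R c)"
      using frame_expansion[OF u o] by simp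
    then have "x + x = (2 * (a \<bullet> x)) *\<^sub>R a + (2 * (b \<bullet> x)) *\<^sub>R b + (2 * (c \<bullet> x)) *\<^sub>R c"
      by (simp only: scaleR_add_right scaleR_scaleR flip: scaleR_2)
    then have "x - (2 * (a \<bullet> x)) *\<^sub>R a - (2 * (b \<bullet> x)) *\<^sub>R b = (2 * (c \<bullet> x)) *\<^sub>R c - x"
      by (simp add: algebra_simps)
    moreover have "half_turn (line_of p) (half_turn (line_of q) x) =
        x - (2 * (a \<bullet> x)) *\<^sub>R a - (2 * (b \<bullet> x)) *\<^sub>R b"
      using o by (simp add: pt half_turn_pt u inner_diff_right)
    moreover have "half_turn (line_of r) x = (2 * (c \<bullet> x)) *\<^sub>R c - x"
      by (simp add: pt half_turn_pt u)
    ultimately show ?thesis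
      by simp
  qed
  then show ?thesis
    by (intro ext) (simp add: iota.rep_eq image_image flip: line_of_inject)
qed

text \<open>If the points differed, \<open>p\<close> would be fixed by \<open>iota q\<close>, hence
  polar to \<open>q\<close>. The composite of the two involutions would then be the third involution
  of a polar frame, but equal involutions compose to the identity.\<close>

lemma iota_eq_imp_eq:
  assumes "iota p = iota q"
  shows "p = q"
proof (rule ccontr)
  assume ne: "p \<noteq> q"
  have "iota q p = p"
    using assms iota_fixed_points[of p p] by simp
  then have o: "rp2_orthogonal p q"
    using ne iota_fixed_points[of q p] rp2_orthogonal_sym by blast
  obtain a b where u: "norm a = 1" "norm b = 1" and pt: "p = pt a" "q = pt b"
    using rp2_obtain_pt[of 1] by (metis zero_less_one)
  obtain c where c: "norm c = 1" "c \<bullet> a = 0" "c \<bullet> b = 0"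
    using exists_unit_orthogonal_to_pair .
  have "a \<noteq> 0" "b \<noteq> 0" "c \<noteq> 0"
    using u c by auto
  then have "iota p \<circ> iota q = iota (pt c)"
    using o c unfolding pt by (intro iota_polar_frame) (auto simp: rp2_orthogonal_pt inner_commute)
  moreover have "iota p \<circ> iota q = id"
    using assms by (auto simp: iota_iota)
  ultimately show False
    using iota_not_id by metis
qed


text \<open>Half turns about two lines in the plane orthogonal to \<open>n\<close> compose to the
  rotation about \<open>n\<close> by twice the oriented angle between the lines. So \<open>s\<close>
  has to make the same oriented angle with \<open>c\<close> as \<open>p\<close> makes with
  \<open>q\<close>.\<close>

lemma pencil_slide:
  fixes n :: "real^3"
  assumes n: "norm n = 1" and p: "norm p = 1" "n \<bullet> p = 0" and q: "norm q = 1" "n \<bullet> q = 0"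
    and c: "norm c = 1" "n \<bullet> c = 0"
  obtains s where "rp2_collinear {pt q, pt p, pt c, s}"
    "rp2_dist (pt q) (pt p) = rp2_dist (pt c) s" "rp2_dist (pt q) (pt c) = rp2_dist (pt p) s"
    "iota (pt p) \<circ> iota (pt q) = iota s \<circ> iota (pt c)"
proof -
  obtain e where e: "norm e = 1" "n \<bullet> e = 0" "c \<bullet> e = 0"
    using exists_unit_orthogonal_to_pair[of n c] by (metis inner_commute)
  have cc: "c \<bullet> c = 1" "e \<bullet> e = 1" "e \<bullet> c = 0" "c \<bullet> e = 0"
    using c e by (simp_all add: dot_square_norm inner_commute)
  have plane: "(c \<bullet> x) *\<^sub>R c + (e \<bullet> x) *\<^sub>R e = x" if "n \<bullet> x = 0" for x
    using frame_expansion[OF n c(1) e(1) c(2) e(2,3), of x] that by simp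
  define p1 p2 q1 q2 where "p1 = c \<bullet> p" "p2 = e \<bullet> p" "q1 = c \<bullet> q" "q2 = e \<bullet> q"
  note coords = this
  have pe: "p = p1 *\<^sub>R c + p2 *\<^sub>R e" and qe: "q = q1 *\<^sub>R c + q2 *\<^sub>R e"
    using plane p q by (simp_all add: coords)
  have "p \<bullet> p = p1\<^sup>2 + p2\<^sup>2" "q \<bullet> q = q1\<^sup>2 + q2\<^sup>2"
    unfolding pe qe by (simp_all add: inner_add_left inner_add_right cc power2_eq_square)
  then have pp: "p1\<^sup>2 + p2\<^sup>2 = 1" and qq: "q1\<^sup>2 + q2\<^sup>2 = 1"
    using p q by (simp_all add: dot_square_norm)
  \<comment> \<open>In the plane with basis \<open>c = 1\<close>, \<open>e = i\<close>, this is the product of \<open>p\<close> and the conjugate of \<open>q\<close>.\<close>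
  define s1 s2 where "s1 = p1 * q1 + p2 * q2" "s2 = p2 * q1 - p1 * q2"
  note s12 = this
  define s where "s = s1 *\<^sub>R c + s2 *\<^sub>R e"
  \<comment> \<open>Multiplicativity of the complex norm.\<close>
  have "s1\<^sup>2 + s2\<^sup>2 = (p1\<^sup>2 + p2\<^sup>2) * (q1\<^sup>2 + q2\<^sup>2)"
    unfolding s12 by algebra
  then have ss: "s \<bullet> s = 1"
    unfolding s_def using pp qq
    by (simp add: inner_add_left inner_add_right cc flip: power2_eq_square)
  then have s: "norm s = 1"
    by (simp add: norm_eq_sqrt_inner)
  have ns: "n \<bullet> s = 0"
    using c e by (simp add: s_def inner_add_right)
  have ne: "p \<noteq> 0" "q \<noteq> 0" "c \<noteq> 0" "s \<noteq> 0" "n \<noteq> 0"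
    using p q c s n by auto
  \<comment> \<open>These yield the two distance equations. In complex terms the products are the
    real parts of \<open>p\<close> times the conjugate of \<open>q\<close>, and of \<open>q\<close>
    times the squared norm of \<open>p\<close>.\<close>
  have dots: "q \<bullet> p = c \<bullet> s" "q \<bullet> c = p \<bullet> s"
  proof -
    show "q \<bullet> p = c \<bullet> s"
      unfolding pe qe s_def s12 by (simp add: inner_add_left inner_add_right cc algebra_simps)
    have "p \<bullet> s = p1 * s1 + p2 * s2"
      unfolding pe s_def by (simp add: inner_add_left inner_add_right cc)
    also have "\<dots> = q1 * (p1\<^sup>2 + p2\<^sup>2)"
      unfolding s12 by algebra
    finally show "q \<bullet> c = p \<bullet> s"
      using pp by (simp add: coords inner_commute)
  qed
  show ?thesis
  proof (rule that[of "pt s"])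
    have sub: "span {x} \<subseteq> {y. n \<bullet> y = 0}" if "n \<bullet> x = 0" for x
      using that by (intro span_minimal subspace_hyperplane) auto
    then show "rp2_collinear {pt q, pt p, pt c, pt s}"
      unfolding rp2_collinear_def using ne p q c ns
      by (intro exI[of _ "{y. n \<bullet> y = 0}"]) (simp add: subspace_hyperplane dim_hyperplane line_of_pt)
    show "rp2_dist (pt q) (pt p) = rp2_dist (pt c) (pt s)" "rp2_dist (pt q) (pt c) = rp2_dist (pt p) (pt s)"
      using ne p q c s dots by (simp_all add: rp2_dist_pt_eq_iff)
    show "iota (pt p) \<circ> iota (pt q) = iota (pt s) \<circ> iota (pt c)"
    proof (rule iota_comp_eqI)
      fix x
      define X Y where "X = c \<bullet> x" "Y = e \<bullet> x"
      note XY = this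
      \<comment> \<open>The composite differs from the identity by a vector of the plane, so
        comparing two composites amounts to comparing two coefficients.\<close>
      have two: "half_turn (line_of (pt a)) (half_turn (line_of (pt b)) x) =
          (2 * (2 * (b1*X + b2*Y) * (a1*b1 + a2*b2) - (a1*X + a2*Y)) * a1 - 2 * (b1*X + b2*Y) * b1) *\<^sub>R c +
          (2 * (2 * (b1*X + b2*Y) * (a1*b1 + a2*b2) - (a1*X + a2*Y)) * a2 - 2 * (b1*X + b2*Y) * b2) *\<^sub>R e + x"
        if "norm a = 1" "norm b = 1" "a = a1 *\<^sub>R c + a2 *\<^sub>R e" "b = b1 *\<^sub>R c + b2 *\<^sub>R e" for a b a1 a2 b1 b2
      proof -
        have "a \<bullet> b = a1*b1 + a2*b2" "a \<bullet> x = a1*X + a2*Y" "b \<bullet> x = b1*X + b2*Y"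
          unfolding that(3,4) XY by (simp_all add: inner_add_left inner_add_right cc)
        then have "half_turn (line_of (pt a)) (half_turn (line_of (pt b)) x) =
          (2 * (2 * (b1*X + b2*Y) * (a1*b1 + a2*b2) - (a1*X + a2*Y))) *\<^sub>R a - ((2 * (b1*X + b2*Y)) *\<^sub>R b - x)"
          by (simp add: half_turn_pt that(1,2) inner_diff_right)
        then show ?thesis
          by (simp add: that(3,4) scaleR_add_right scaleR_diff_left add.commute)
      qed
      \<comment> \<open>Polynomial identities modulo \<open>pp\<close> and \<open>qq\<close>. The
        constants 1 and 0 on the right are the coordinates of \<open>c\<close>.\<close>
      have "2 * (2 * (q1*X + q2*Y) * (p1*q1 + p2*q2) - (p1*X + p2*Y)) * p1 - 2 * (q1*X + q2*Y) * q1 =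
          2 * (2 * (1*X + 0*Y) * (s1*1 + s2*0) - (s1*X + s2*Y)) * s1 - 2 * (1*X + 0*Y) * 1"
        "2 * (2 * (q1*X + q2*Y) * (p1*q1 + p2*q2) - (p1*X + p2*Y)) * p2 - 2 * (q1*X + q2*Y) * q2 =
          2 * (2 * (1*X + 0*Y) * (s1*1 + s2*0) - (s1*X + s2*Y)) * s2 - 2 * (1*X + 0*Y) * 0"
        using pp qq unfolding s12 by algebra+
      moreover have "c = 1 *\<^sub>R c + 0 *\<^sub>R e"
        by simp
      ultimately show "half_turn (line_of (pt p)) (half_turn (line_of (pt q)) x) =
          half_turn (line_of (pt s)) (half_turn (line_of (pt c)) x)"
        using two[OF p(1) q(1) pe qe] two[OF s c(1) s_def, of 1 0] by simp
    qed
  qed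
qed

text \<open>The conclusions are the premises of one pencil and one polar frame relation, in the
  argument order in which these are applied later.\<close>

lemma three_to_two:
  obtains c s d where "rp2_collinear {q, p, c, s}"
    "rp2_dist q p = rp2_dist c s" "rp2_dist q c = rp2_dist p s"
    "iota p \<circ> iota q = iota s \<circ> iota c"
    "rp2_orthogonal r d" "rp2_orthogonal d c" "rp2_orthogonal r c"
proof -
  obtain u v w where u: "norm u = 1" "norm v = 1" "norm w = 1"
    and pt: "p = pt u" "q = pt v" "r = pt w"
    using rp2_obtain_pt[of 1] by (metis zero_less_one)
  obtain n where n: "norm n = 1" "n \<bullet> u = 0" "n \<bullet> v = 0"
    using exists_unit_orthogonal_to_pair .
  \<comment> \<open>Orthogonality to \<open>n\<close> puts \<open>c\<close> on a projective line
    through \<open>p\<close> and \<open>q\<close>, orthogonality to \<open>w\<close> on the line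
    polar to \<open>r\<close>.\<close>
  obtain c where c: "norm c = 1" "c \<bullet> n = 0" "c \<bullet> w = 0"
    using exists_unit_orthogonal_to_pair .
  obtain d where d: "norm d = 1" "d \<bullet> c = 0" "d \<bullet> w = 0"
    using exists_unit_orthogonal_to_pair .
  obtain s where s: "rp2_collinear {q, p, pt c, s}"
    "rp2_dist q p = rp2_dist (pt c) s" "rp2_dist q (pt c) = rp2_dist p s"
    "iota p \<circ> iota q = iota s \<circ> iota (pt c)"
    unfolding pt using pencil_slide[of n u v c] n u c by (metis inner_commute)
  have "w \<noteq> 0" "c \<noteq> 0" "d \<noteq> 0"
    using u c d by auto
  then have "rp2_orthogonal r (pt d)" "rp2_orthogonal (pt d) (pt c)" "rp2_orthogonal r (pt c)"
    unfolding pt using c d by (simp_all add: rp2_orthogonal_pt inner_commute)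
  with s show ?thesis
    using that by blast
qed

section \<open>Words in an arbitrary group whose elements satisfy the three kinds of
  relations\<close>

definition (in group) word_product :: "('c \<Rightarrow> 'a) \<Rightarrow> 'c list \<Rightarrow> 'a" where
  "word_product X ps = foldr (\<otimes>) (map X ps) \<one>"

text \<open>The same \<open>a\<close> and \<open>b\<close> serve for the abstract product and for
  the composition of isometries. This lets triviality of the composition carry over to the
  product.\<close>

lemma (in group) word_reduces_to_length_two:
  fixes X :: "rp2 \<Rightarrow> 'a"
  assumes carrier: "\<And>p. X p \<in> carrier G"
    and involution: "\<And>p. X p \<otimes> X p = \<one>"
    and pencil: "\<And>p q r s. rp2_collinear {p, q, r, s} \<Longrightarrow> rp2_dist p q = rp2_dist r s \<Longrightarrow>
      rp2_dist p r = rp2_dist q s \<Longrightarrow> iota q \<circ> iota p = iota s \<circ> iota r \<Longrightarrow>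
      X q \<otimes> X p = X s \<otimes> X r"
    and polar: "\<And>p q r. rp2_orthogonal p q \<Longrightarrow> rp2_orthogonal q r \<Longrightarrow> rp2_orthogonal p r \<Longrightarrow>
      X r \<otimes> X q \<otimes> X p = \<one>"
  shows "\<exists>a b. word_product X (p # q # ps) = X a \<otimes> X b \<and>
    iota_composition (p # q # ps) = iota a \<circ> iota b"
proof (induction ps arbitrary: p q)
  case Nil
  then show ?case
    using carrier by (auto simp: word_product_def iota_composition_def)
next
  case (Cons r ps)
  obtain a b where ab: "word_product X (q # r # ps) = X a \<otimes> X b"
    "iota_composition (q # r # ps) = iota a \<circ> iota b"
    using Cons.IH by blast
  obtain c s d where red: "rp2_collinear {a, p, c, s}"
    "rp2_dist a p = rp2_dist c s" "rp2_dist a c = rp2_dist p s"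
    "iota p \<circ> iota a = iota s \<circ> iota c"
    and perp: "rp2_orthogonal b d" "rp2_orthogonal d c" "rp2_orthogonal b c"
    using three_to_two .
  have "X c \<otimes> X d \<otimes> X b = \<one>"
    using polar[OF perp] .
  \<comment> \<open>The polar frame relation makes \<open>X c \<otimes> X d\<close> the inverse of
    \<open>X b\<close>, which is its own inverse.\<close>
  then have b: "X b = X c \<otimes> X d"
    by (metis carrier involution inv_equality inv_inv inv_unique' m_closed)
  have "word_product X (p # q # r # ps) = X p \<otimes> (X a \<otimes> X b)"
    using ab(1) by (simp add: word_product_def)
  also have "\<dots> = (X s \<otimes> X c) \<otimes> (X c \<otimes> X d)"
    using pencil[OF red] carrier b by (metis m_assoc)
  also have "\<dots> = X s \<otimes> X d"
    by (metis carrier involution m_assoc m_closed l_one)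
  finally have "word_product X (p # q # r # ps) = X s \<otimes> X d" .
  moreover have "iota_composition (p # q # r # ps) = iota s \<circ> iota d"
  proof -
    \<comment> \<open>The same reduction is repeated among the isometries, where the relations are
      facts about half turns.\<close>
    have "iota c \<circ> iota d = iota b"
      using perp[THEN rp2_orthogonal_sym] by (intro iota_polar_frame)
    then have "iota a \<circ> iota b = iota a \<circ> (iota c \<circ> iota d)"
      by simp
    then have "iota_composition (p # q # r # ps) = (iota p \<circ> iota a) \<circ> (iota c \<circ> iota d)"
      using ab(2) by (simp add: iota_composition_def comp_assoc)
    also have "\<dots> = iota s \<circ> iota d"
      unfolding red(4) by (simp add: fun_eq_iff iota_iota)
    finally show ?thesis .
  qed
  ultimately show ?case
    by blast
qed


text \<open>A single letter cannot compose to the identity, and a longer word shrinks to a pair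
  \<open>a\<close>, \<open>b\<close> whose involutions agree, so that \<open>a = b\<close> and the
  involution relation applies.\<close>

lemma (in group) word_product_eq_one:
  fixes X :: "rp2 \<Rightarrow> 'a"
  assumes carrier: "\<And>p. X p \<in> carrier G"
    and involution: "\<And>p. X p \<otimes> X p = \<one>"
    and pencil: "\<And>p q r s. rp2_collinear {p, q, r, s} \<Longrightarrow> rp2_dist p q = rp2_dist r s \<Longrightarrow>
      rp2_dist p r = rp2_dist q s \<Longrightarrow> iota q \<circ> iota p = iota s \<circ> iota r \<Longrightarrow>
      X q \<otimes> X p = X s \<otimes> X r"
    and polar: "\<And>p q r. rp2_orthogonal p q \<Longrightarrow> rp2_orthogonal q r \<Longrightarrow> rp2_orthogonal p r \<Longrightarrow>
      X r \<otimes> X q \<otimes> X p = \<one>"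
    and id: "iota_composition ps = id"
  shows "word_product X ps = \<one>"
proof -
  consider "ps = []" | p where "ps = [p]" | p q qs where "ps = p # q # qs"
    by (cases ps rule: remdups_adj.cases) auto
  then show ?thesis
  proof cases
    case 1
    then show ?thesis
      by (simp add: word_product_def)
  next
    case 2
    then show ?thesis
      using id iota_not_id by (simp add: iota_composition_def)
  next
    case 3
    obtain a b where ab: "word_product X ps = X a \<otimes> X b" "iota_composition ps = iota a \<circ> iota b"
      using word_reduces_to_length_two[of X p q qs] assms(1-4) 3 by blast
    have "iota a = iota b"
      using id ab(2) iota_iota by (metis comp_apply eq_id_iff ext)
    then have "a = b"
      by (rule iota_eq_imp_eq)
    then show ?thesis
      using ab(1) involution by simp
  qed
qed

section \<open>Normality of the normal closure\<close>

lemma normal_closure_normal: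
  assumes "group G" "S \<subseteq> carrier G"
  shows "normal_closure G S \<lhd> G"
proof -
  interpret group G
    by (rule assms(1))
  let ?A = "{N. N \<lhd> G \<and> S \<subseteq> N}"
  have "carrier G \<lhd> G"
    by (intro normal_invI subgroup_self) simp
  \<comment> \<open>An empty family would have the whole type as its intersection.\<close>
  then have ne: "?A \<noteq> {}"
    using assms(2) by blast
  have "subgroup (\<Inter>?A) G"
    using ne by (intro subgroups_Inter) (auto simp: normal_imp_subgroup)
  then show ?thesis
    unfolding normal_closure_def
    by (rule normal_invI) (auto dest: normal.inv_op_closed2)
qed

section \<open>Isometries are products of involutions\<close>

abbreviation ax :: "3 \<Rightarrow> real^3" where
  "ax k \<equiv> axis k 1"

text \<open>No linear lift of \<open>f\<close> is available, so \<open>f\<close> is studied only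
  through absolute values of inner products of representatives.\<close>

lemma isometry_inner:
  assumes "f \<in> carrier isometry_group" "f (pt x) = pt y" "f (pt w) = pt z"
    "norm y = norm x" "norm z = norm w" "x \<noteq> 0" "w \<noteq> 0"
  shows "\<bar>y \<bullet> z\<bar> = \<bar>x \<bullet> w\<bar>"
proof -
  have "rp2_dist (f (pt x)) (f (pt w)) = rp2_dist (pt x) (pt w)"
    using assms(1) by (simp add: isometry_group_def)
  then show ?thesis
    using assms(2-) rp2_dist_pt_eq_iff[of x y w z] by simp
qed

lemma isometry_comp_iota:
  "f \<in> carrier isometry_group \<Longrightarrow> iota p \<circ> f \<in> carrier isometry_group"
  using group.is_monoid[OF group_isometry_group] iota_isometry[of p]
    monoid.m_closed[of isometry_group "iota p" f]
  by (simp add: isometry_group_def)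

lemma generated_if_iota_comp_generated:
  assumes "iota p \<circ> f \<in> generate isometry_group (range iota)"
  shows "f \<in> generate isometry_group (range iota)"
proof -
  have "iota p \<circ> (iota p \<circ> f) \<in> generate isometry_group (range iota)"
    using generate.eng[OF generate.incl[of "iota p"] assms] by (simp add: isometry_group_def)
  moreover have "iota p \<circ> (iota p \<circ> f) = f"
    by (simp add: fun_eq_iff iota_iota)
  ultimately show ?thesis
    by simp
qed

text \<open>The half turn about the bisector \<open>u + v\<close> exchanges \<open>u\<close> and
  \<open>v\<close>; a vector orthogonal to both is orthogonal to the axis, so its line is
  fixed.\<close>

lemma iota_moving:
  assumes "norm u = norm v" "u \<noteq> 0"
  obtains m where "iota m (pt u) = pt v"
    "\<And>w. w \<noteq> 0 \<Longrightarrow> w \<bullet> u = 0 \<Longrightarrow> w \<bullet> v = 0 \<Longrightarrow> iota m (pt w) = pt w"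
proof (cases "u + v = 0")
  \<comment> \<open>The bisector vanishes, but the two points coincide and the half turn about
    \<open>u\<close> serves.\<close>
  case True
  then have "v = - u"
    by (simp add: eq_neg_iff_add_eq_0 add.commute)
  then have "pt v = pt u"
    by (simp add: pt_minus)
  moreover have "iota (pt u) (pt w) = pt w" if "w \<noteq> 0" "w \<bullet> u = 0" for w
    using that assms(2) iota_fixed_points by (simp add: rp2_orthogonal_pt inner_commute)
  moreover have "iota (pt u) (pt u) = pt u"
    using iota_fixed_points by blast
  ultimately show ?thesis
    using that by metis
next
  case False
  define a where "a = (u + v) /\<^sub>R norm (u + v)"
  have a: "norm a = 1" "a \<noteq> 0"
    using False by (auto simp: a_def)
  have "u \<bullet> u = v \<bullet> v"
    using assms(1) by (simp flip: power2_norm_eq_inner)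
  then have "2 * ((u + v) \<bullet> u) = (norm (u + v))\<^sup>2"
    unfolding power2_norm_eq_inner by (simp add: inner_add_left inner_add_right inner_commute)
  moreover have "(2 * (a \<bullet> u)) *\<^sub>R a = (2 * ((u + v) \<bullet> u) / (norm (u + v))\<^sup>2) *\<^sub>R (u + v)"
    by (simp add: a_def power2_eq_square divide_inverse mult_ac)
  ultimately have "(2 * (a \<bullet> u)) *\<^sub>R a = u + v"
    using False by simp
  then have "iota (pt a) (pt u) = pt v"
    using iota_pt[OF a(1) assms(2)] by simp
  moreover have "iota (pt a) (pt w) = pt w" if "w \<noteq> 0" "w \<bullet> u = 0" "w \<bullet> v = 0" for w
  proof -
    have "a \<bullet> w = 0"
      using that by (simp add: a_def inner_add_right inner_commute[of _ w])
    then show ?thesis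
      using that a iota_fixed_points by (simp add: rp2_orthogonal_pt)
  qed
  ultimately show ?thesis
    using that by blast
qed

lemma isometry_fixing_frame_eq_id:
  assumes f: "f \<in> carrier isometry_group" and fix_ax: "\<And>k. f (pt (ax k)) = pt (ax k)"
    and fix_one: "f (pt 1) = pt 1"
  shows "f = id"
proof -
  have coord: "\<bar>y $ k\<bar> = \<bar>x $ k\<bar>" if "f (pt x) = pt y" "norm y = norm x" "x \<noteq> 0" for x y k
    using isometry_inner[OF f that(1) fix_ax that(2) refl that(3), of k]
    by (simp add: inner_axis axis_eq_0_iff)
  have nonneg: "f (pt x) = pt x" if "\<And>k. x $ k \<ge> 0" "x \<noteq> 0" for x
  proof -
    obtain y where y: "norm y = norm x" "f (pt x) = pt y"
      using rp2_obtain_pt[of "norm x"] \<open>x \<noteq> 0\<close> by (metis zero_less_norm_iff)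
    have "\<bar>y \<bullet> 1\<bar> = \<bar>x \<bullet> 1\<bar>"
      using isometry_inner[OF f y(2) fix_one y(1) refl that(2)] by simp
    then have "\<bar>y $ 1 + y $ 2 + y $ 3\<bar> = \<bar>x $ 1 + x $ 2 + x $ 3\<bar>"
      by (simp add: inner_vec_def sum_3)
    \<comment> \<open>The coordinates of \<open>y\<close> are those of the nonnegative
      \<open>x\<close> up to sign, so the two sums agree in absolute value only if no signs are
      mixed.\<close>
    then have "y = x \<or> y = - x"
      using coord[OF y(2,1) that(2), of 1] coord[OF y(2,1) that(2), of 2]
        coord[OF y(2,1) that(2), of 3] that(1)[of 1] that(1)[of 2] that(1)[of 3]
      unfolding vec_eq_iff forall_3 vector_uminus_component by (smt (verit))
    then show ?thesis
      using y(2) pt_minus by metis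
  qed
  show ?thesis
  proof
    fix p
    obtain x where x: "norm x = 1" "p = pt x"
      using rp2_obtain_pt[of 1] by (metis zero_less_one)
    obtain y where y: "norm y = norm x" "f (pt x) = pt y"
      using rp2_obtain_pt[of "norm x"] x(1) by (metis zero_less_one)
    have "x \<noteq> 0"
      using x by auto
    \<comment> \<open>Squaring shows that this fixes the product of the two coordinates, hence their
      relative sign when neither is zero.\<close>
    have two: "\<bar>y $ i + y $ j\<bar> = \<bar>x $ i + x $ j\<bar>" if "i \<noteq> j" for i j
    proof -
      have ne: "ax i + ax j \<noteq> 0"
        using that by (auto simp: vec_eq_iff axis_def)
      have "f (pt (ax i + ax j)) = pt (ax i + ax j)"
        by (rule nonneg[OF _ ne]) (simp add: axis_def)
      then show ?thesis
        using isometry_inner[OF f y(2) _ y(1) refl \<open>x \<noteq> 0\<close> ne]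
        by (simp add: inner_add_right inner_axis)
    qed
    have "y = x \<or> y = - x"
      using coord[OF y(2,1) \<open>x \<noteq> 0\<close>, of 1] coord[OF y(2,1) \<open>x \<noteq> 0\<close>, of 2]
        coord[OF y(2,1) \<open>x \<noteq> 0\<close>, of 3] two[of 1 2] two[of 1 3] two[of 2 3]
      unfolding vec_eq_iff forall_3 vector_uminus_component by simp (smt (verit))
    then show "f p = id p"
      using y(2) x(2) pt_minus by (metis id_apply)
  qed
qed

lemma exists_3_iff: "(\<exists>k::3. P k) \<longleftrightarrow> P 1 \<or> P 2 \<or> P 3"
  by (metis exhaust_3)

text \<open>The axes are brought back one after another, and each new involution fixes those already
  in place.\<close>

lemma isometry_generated:
  assumes f: "f \<in> carrier isometry_group"
  shows "f \<in> generate isometry_group (range iota)"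
proof -
  have ne: "ax k \<noteq> 0" and ortho: "k \<noteq> l \<Longrightarrow> ax k \<bullet> ax l = 0" for k l
    by (auto simp: axis_eq_0_iff inner_axis_axis)
  have image: "\<exists>v. norm v = norm u \<and> p = pt v" if "u \<noteq> 0" for u :: "real^3" and p
    using rp2_obtain_pt[of "norm u" p] that by (metis zero_less_norm_iff)
  obtain v1 where v1: "norm v1 = norm (ax 1)" "f (pt (ax 1)) = pt v1"
    using image ne by blast
  obtain m1 where m1: "iota m1 (pt v1) = pt (ax 1)"
    using iota_moving[of v1 "ax 1"] v1(1) ne[of 1] by (metis norm_eq_zero)
  define f1 where "f1 = iota m1 \<circ> f"
  have f1: "f1 \<in> carrier isometry_group" "f1 (pt (ax 1)) = pt (ax 1)"
    using isometry_comp_iota[OF f] v1 m1 by (simp_all add: f1_def)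
  obtain v2 where v2: "norm v2 = norm (ax 2)" "f1 (pt (ax 2)) = pt v2"
    using image ne by blast
  \<comment> \<open>The isometry \<open>f1\<close> preserves orthogonality and fixes the first axis;
    hence the involution moving \<open>v2\<close> to the second axis leaves the first one
    fixed.\<close>
  have "v2 \<bullet> ax 1 = 0"
    using isometry_inner[OF f1(1) v2(2) f1(2) v2(1) refl ne ne] ortho[of 2 1] by simp
  moreover have ax12: "ax 1 \<bullet> ax 2 = 0"
    by (rule ortho) simp
  ultimately obtain m2 where m2: "iota m2 (pt v2) = pt (ax 2)" "iota m2 (pt (ax 1)) = pt (ax 1)"
    using iota_moving[of v2 "ax 2"] v2(1) ne[of 1] ne[of 2] ax12
    by (metis inner_commute norm_eq_zero)
  define f2 where "f2 = iota m2 \<circ> f1"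
  have f2: "f2 \<in> carrier isometry_group" "f2 (pt (ax 1)) = pt (ax 1)" "f2 (pt (ax 2)) = pt (ax 2)"
    using isometry_comp_iota[OF f1(1)] f1 v2 m2 by (simp_all add: f2_def)
  obtain v3 where v3: "norm v3 = norm (ax 3)" "f2 (pt (ax 3)) = pt v3"
    using image ne by blast
  \<comment> \<open>The third axis is already in place, being the only line orthogonal to the first
    two.\<close>
  have "v3 $ 1 = 0" "v3 $ 2 = 0"
    using isometry_inner[OF f2(1) v3(2) f2(2) v3(1) refl ne ne] ortho[of 3 1]
      isometry_inner[OF f2(1) v3(2) f2(3) v3(1) refl ne ne] ortho[of 3 2]
    by (simp_all add: inner_axis)
  moreover from this have "\<bar>v3 $ 3\<bar> = 1"
    using v3(1) norm_axis_1[of 3] by (simp add: norm_vec_def[of v3] L2_set_def sum_3)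
  ultimately have "v3 = ax 3 \<or> v3 = - ax 3"
    unfolding vec_eq_iff forall_3 vector_uminus_component by (auto simp: axis_def)
  then have "f2 (pt (ax 3)) = pt (ax 3)"
    using v3(2) pt_minus by metis
  then have f2_ax: "f2 (pt (ax k)) = pt (ax k)" for k
    using f2 exhaust_3[of k] by auto
  have one: "(1::real^3) \<noteq> 0"
    by simp
  obtain v where v: "norm v = norm (1::real^3)" "f2 (pt 1) = pt v"
    using image one by blast
  \<comment> \<open>Equal angles with the fixed axes leave only the signs of the coordinates of
    \<open>v\<close> open.\<close>
  have v_coord: "\<bar>v $ k\<bar> = 1" for k
    using isometry_inner[OF f2(1) v(2) f2_ax v(1) refl one ne, of k] by (simp add: inner_axis)
  have "v \<noteq> 0"
    using v(1) one by (metis norm_eq_zero)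
  \<comment> \<open>The four sign patterns of \<open>v\<close> up to \<open>\<plusminus>\<close> are permuted transitively by the half turns about the axes.\<close>
  have "pt v = pt 1 \<or> (\<exists>k. iota (pt (ax k)) (pt v) = pt 1)"
  proof -
    have "v = 1 \<or> v = - 1 \<or> (\<exists>k. (2 * v $ k) *\<^sub>R ax k - v = 1 \<or> (2 * v $ k) *\<^sub>R ax k - v = - 1)"
      using v_coord[of 1] v_coord[of 2] v_coord[of 3]
      unfolding exists_3_iff vec_eq_iff forall_3 by (auto simp: axis_def abs_if split: if_splits)
    moreover have "iota (pt (ax k)) (pt v) = pt ((2 * v $ k) *\<^sub>R ax k - v)" for k
      using iota_pt[of "ax k" v] \<open>v \<noteq> 0\<close> by (simp add: inner_axis inner_commute)
    ultimately show ?thesis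
      by (metis pt_minus)
  qed
  moreover have "f2 \<in> generate isometry_group (range iota)" if "pt v = pt 1"
  proof -
    have "f2 = id"
      using isometry_fixing_frame_eq_id[OF f2(1) f2_ax] v(2) that by simp
    then show ?thesis
      using generate.one[of isometry_group] by (simp add: isometry_group_def)
  qed
  moreover have "f2 \<in> generate isometry_group (range iota)"
    if k: "iota (pt (ax k)) (pt v) = pt 1" for k
  proof -
    \<comment> \<open>Correcting the signs by a half turn about an axis does not disturb the
      axes.\<close>
    have "iota (pt (ax k)) (pt (ax l)) = pt (ax l)" for l
      using iota_fixed_points ortho[of k l] ne by (cases "k = l") (auto simp: rp2_orthogonal_pt)
    then have "iota (pt (ax k)) \<circ> f2 = id"
      using isometry_fixing_frame_eq_id[OF isometry_comp_iota[OF f2(1), of "pt (ax k)"]] f2_ax v(2) k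
      by simp
    then show ?thesis
      using generate.one[of isometry_group] generated_if_iota_comp_generated[of "pt (ax k)" f2]
      by (simp add: isometry_group_def)
  qed
  ultimately show ?thesis
    unfolding f2_def f1_def using generated_if_iota_comp_generated by blast
qed

section \<open>Generation, and relations via the quotient of the free group\<close>

theorem mainTheorem7:
  shows "generate isometry_group (range iota) = carrier isometry_group \<and>
    (\<forall>ps. iota_composition ps = id \<longrightarrow>
       relation_word ps \<in> normal_closure free_group
         (involution_relators \<union> pencil_relators \<union> polar_frame_relators))"
proof (intro conjI allI impI)
  show "generate isometry_group (range iota) = carrier isometry_group"
    using group.generate_incl[OF group_isometry_group, of "range iota"] iota_isometry isometry_generated
    by blast
next
  fix ps
  assume id: "iota_composition ps = id"
  let ?R = "involution_relators \<union> pencil_relators \<union> polar_frame_relators"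
  define F where "F = (free_group :: rp2 free_group monoid)"
  define N where "N = normal_closure F ?R"
  interpret F: group F
    unfolding F_def by (rule group_free_group)
  have carrier: "g \<in> carrier F" for g
    by (simp add: F_def free_group_def)
  interpret N: normal N F
    unfolding N_def using carrier by (intro normal_closure_normal F.is_group) auto
  interpret Q: group "F Mod N"
    by (rule N.factorgroup_is_group)
  define h where "h g = N #>\<^bsub>F\<^esub> g" for g
  interpret h: group_hom F "F Mod N" h
    using N.r_coset_hom_Mod by unfold_locales (simp add: h_def[abs_def])
  \<comment> \<open>The kernel of the projection is \<open>N\<close>, so membership in the normal
    closure becomes triviality in the quotient, where all relators vanish.\<close>
  have h_one_iff: "h g = \<one>\<^bsub>F Mod N\<^esub> \<longleftrightarrow> g \<in> N" for g
    using F.coset_join1[of N g] F.coset_join2[of g N] carrier N.subgroup_axioms by (auto simp: h_def)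
  have relator: "h g = \<one>\<^bsub>F Mod N\<^esub>" if "g \<in> ?R" for g
  proof -
    have "?R \<subseteq> N"
      unfolding N_def normal_closure_def by blast
    then show ?thesis
      using that h_one_iff by blast
  qed
  let ?X = "\<lambda>p. h (fg_gen p)"
  have "Q.word_product ?X ps = \<one>\<^bsub>F Mod N\<^esub>"
  proof (rule Q.word_product_eq_one[OF _ _ _ _ id])
    fix p
    show "?X p \<in> carrier (F Mod N)"
      using carrier by simp
    have "fg_gen p \<otimes>\<^bsub>F\<^esub> fg_gen p \<in> ?R"
      unfolding involution_relators_def F_def by blast
    then show "?X p \<otimes>\<^bsub>F Mod N\<^esub> ?X p = \<one>\<^bsub>F Mod N\<^esub>"
      using relator carrier h.hom_mult by metis
  next
    fix p q r s
    assume "rp2_collinear {p, q, r, s}" "rp2_dist p q = rp2_dist r s"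
      "rp2_dist p r = rp2_dist q s" "iota q \<circ> iota p = iota s \<circ> iota r"
    then have "fg_gen q \<otimes>\<^bsub>F\<^esub> fg_gen p \<otimes>\<^bsub>F\<^esub> inv\<^bsub>F\<^esub> (fg_gen s \<otimes>\<^bsub>F\<^esub> fg_gen r) \<in> ?R"
      unfolding pencil_relators_def F_def by blast
    from relator[OF this]
    have "h (fg_gen q \<otimes>\<^bsub>F\<^esub> fg_gen p) \<otimes>\<^bsub>F Mod N\<^esub> inv\<^bsub>F Mod N\<^esub> h (fg_gen s \<otimes>\<^bsub>F\<^esub> fg_gen r) = \<one>\<^bsub>F Mod N\<^esub>"
      using carrier h.hom_mult h.hom_inv by metis
    then have "h (fg_gen q \<otimes>\<^bsub>F\<^esub> fg_gen p) = h (fg_gen s \<otimes>\<^bsub>F\<^esub> fg_gen r)"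
      using carrier h.hom_closed Q.inv_closed Q.inv_equality Q.inv_inv by metis
    then show "?X q \<otimes>\<^bsub>F Mod N\<^esub> ?X p = ?X s \<otimes>\<^bsub>F Mod N\<^esub> ?X r"
      using carrier h.hom_mult by metis
  next
    fix p q r
    assume "rp2_orthogonal p q" "rp2_orthogonal q r" "rp2_orthogonal p r"
    then have "fg_gen r \<otimes>\<^bsub>F\<^esub> fg_gen q \<otimes>\<^bsub>F\<^esub> fg_gen p \<in> ?R"
      unfolding polar_frame_relators_def F_def by blast
    from relator[OF this]
    show "?X r \<otimes>\<^bsub>F Mod N\<^esub> ?X q \<otimes>\<^bsub>F Mod N\<^esub> ?X p = \<one>\<^bsub>F Mod N\<^esub>"
      using carrier h.hom_mult by metis
  qed
  \<comment> \<open>As a homomorphism, \<open>h\<close> sends the word in the free group to the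
    product of the images of its letters.\<close>
  moreover have "Q.word_product ?X qs = h (relation_word qs)" for qs
  proof (induction qs)
    case Nil
    have "h \<one>\<^bsub>F\<^esub> = \<one>\<^bsub>F Mod N\<^esub>"
      by (rule h.hom_one)
    moreover have "relation_word [] = \<one>\<^bsub>F\<^esub>"
      by (simp add: relation_word_def F_def)
    ultimately show ?case
      by (simp add: Q.word_product_def)
  next
    case (Cons q qs)
    have "h (fg_gen q \<otimes>\<^bsub>F\<^esub> relation_word qs) = ?X q \<otimes>\<^bsub>F Mod N\<^esub> h (relation_word qs)"
      using carrier by (intro h.hom_mult)
    moreover have "relation_word (q # qs) = fg_gen q \<otimes>\<^bsub>F\<^esub> relation_word qs"
      by (simp add: relation_word_def F_def)
    ultimately show ?case
      using Cons by (simp add: Q.word_product_def)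
  qed
  ultimately show "relation_word ps \<in> normal_closure free_group ?R"
    using h_one_iff by (simp add: N_def F_def)
qed

end
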